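(* Let $K$ be an algebraically closed field complete with respect to a non-trivial non-archimedean absolute value $|\cdot|$, with residue characteristic $p\geq 0$, let $d\geq 2$, and assume $\operatorname{char}K=0$ or $\operatorname{char}K>d$. Define $\epsilon=\epsilon^{\mathrm{poly}}_{p,d}=\min\{|m|^m:1\leq m\leq d\}$ (which satisfies $\epsilon\geq\min\{|m|^d:1\leq m\leq d\}$). Let $\varphi(z)\in K[z]$ be a polynomial of degree $d$, and let $\gamma$ be a fixed point of $\varphi$ with $0<|\varphi'(\gamma)|<\epsilon$. Then there is a critical point of $\varphi$ which is strictly attracted to $\gamma$.
   Context: $|m|$ is the absolute value in $K$ of the integer $m$. A point $x$ is strictly attracted to the fixed point $\gamma$ if $\varphi^n(x)\to\gamma$ as $n\to\infty$ and $\varphi^l(x)\neq\gamma$ for all $l\geq 1$. *)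

theory Defs
  imports
    "HOL-Analysis.Analysis"
    "HOL-Computational_Algebra.Polynomial"
    "HOL-Algebra.QuotRing"
begin

locale nonarch_absolute_value =
  fixes v :: "'a::field \<Rightarrow> real"
  assumes nonneg: "0 \<le> v x"
    and eq_zero_iff: "v x = 0 \<longleftrightarrow> x = 0"
    and mult: "v (x * y) = v x * v y"
    and ultrametric: "v (x + y) \<le> max (v x) (v y)"

definition abs_dist :: "('a::field \<Rightarrow> real) \<Rightarrow> 'a \<Rightarrow> 'a \<Rightarrow> real" where
  "abs_dist v x y = v (x - y)"

locale complete_nonarch_field = nonarch_absolute_value +
  assumes nontrivial: "\<exists>x. x \<noteq> 0 \<and> v x \<noteq> 1"
    and complete: "Metric_space.mcomplete UNIV (abs_dist v)"

text \<open>The residue field is the quotient of the closed unit ball by the open unit ball. Its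
  characteristic is defined by the same formula as the library's \<open>CHAR('a)\<close>, which is available
  for type classes only.\<close>

definition valuation_ring :: "('a::field \<Rightarrow> real) \<Rightarrow> 'a ring" where
  "valuation_ring v = \<lparr>carrier = {x. v x \<le> 1}, mult = (*), one = 1, zero = 0, add = (+)\<rparr>"

definition residue_field :: "('a::field \<Rightarrow> real) \<Rightarrow> 'a set ring" where
  "residue_field v = valuation_ring v Quot {x. v x < 1}"

definition residue_char :: "('a::field \<Rightarrow> real) \<Rightarrow> nat" where
  "residue_char v =
     Gcd {n. add_pow (residue_field v) n \<one>\<^bsub>residue_field v\<^esub> = \<zero>\<^bsub>residue_field v\<^esub>}"

text \<open>The residue characteristic is not an argument: it is determined by \<open>v\<close>, through which the
  values \<open>|m|\<close> are taken.\<close>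

definition poly_epsilon :: "('a::field \<Rightarrow> real) \<Rightarrow> nat \<Rightarrow> real" where
  "poly_epsilon v d = Min ((\<lambda>m. v (of_nat m) ^ m) ` {1..d})"

definition strictly_attracted :: "('a::field \<Rightarrow> real) \<Rightarrow> ('a \<Rightarrow> 'a) \<Rightarrow> 'a \<Rightarrow> 'a \<Rightarrow> bool" where
  "strictly_attracted v f \<gamma> x \<longleftrightarrow>
     limitin (Metric_space.mtopology UNIV (abs_dist v)) (\<lambda>n. (f ^^ n) x) \<gamma> sequentially \<and>
     (\<forall>l\<ge>1. (f ^^ l) x \<noteq> \<gamma>)"

context nonarch_absolute_value
begin

lemma v_zero [simp]: "v 0 = 0"
  by (simp add: eq_zero_iff)

lemma v_one [simp]: "v 1 = 1"
  using mult[of 1 1] eq_zero_iff[of 1] by simp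

lemma v_minus [simp]: "v (- x) = v x"
proof -
  have "v (- 1) * v (- 1) = 1"
    using mult[of "- 1" "- 1"] by simp
  hence "v (- 1) = 1"
    using nonneg[of "- 1"] by (metis abs_of_nonneg abs_1 abs_mult_self_eq real_sqrt_abs2 real_sqrt_one)
  thus ?thesis
    using mult[of "- 1" x] by simp
qed

lemma Metric_space_abs_dist: "Metric_space UNIV (abs_dist v)"
proof
  fix x y z :: 'a
  show "0 \<le> abs_dist v x y"
    by (simp add: abs_dist_def nonneg)
  show "abs_dist v x y = abs_dist v y x"
    unfolding abs_dist_def by (metis v_minus minus_diff_eq)
  show "abs_dist v x y = 0 \<longleftrightarrow> x = y"
    by (simp add: abs_dist_def eq_zero_iff)
  show "abs_dist v x z \<le> abs_dist v x y + abs_dist v y z"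
    using ultrametric[of "x - y" "y - z"] nonneg[of "x - y"] nonneg[of "y - z"]
    by (simp add: abs_dist_def)
qed

lemma strictly_attracted_iff:
  "strictly_attracted v f \<gamma> x \<longleftrightarrow>
     (\<lambda>n. v ((f ^^ n) x - \<gamma>)) \<longlonglongrightarrow> 0 \<and> (\<forall>l\<ge>1. (f ^^ l) x \<noteq> \<gamma>)"
proof -
  interpret Metric_space UNIV "abs_dist v"
    by (rule Metric_space_abs_dist)
  show ?thesis
    by (simp add: strictly_attracted_def limitin_metric_dist_null abs_dist_def)
qed

lemma cring_valuation_ring: "cring (valuation_ring v)"
proof (rule cringI)
  show "abelian_group (valuation_ring v)"
  proof (rule abelian_groupI)
    fix x y assume "x \<in> carrier (valuation_ring v)" "y \<in> carrier (valuation_ring v)"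
    thus "x \<oplus>\<^bsub>valuation_ring v\<^esub> y \<in> carrier (valuation_ring v)"
      using ultrametric[of x y] by (auto simp: valuation_ring_def)
  next
    fix x assume "x \<in> carrier (valuation_ring v)"
    thus "\<exists>y\<in>carrier (valuation_ring v). y \<oplus>\<^bsub>valuation_ring v\<^esub> x = \<zero>\<^bsub>valuation_ring v\<^esub>"
      by (intro bexI[of _ "- x"]) (auto simp: valuation_ring_def)
  qed (auto simp: valuation_ring_def algebra_simps)
  show "comm_monoid (valuation_ring v)"
    by (rule comm_monoidI)
       (auto simp: valuation_ring_def mult nonneg mult_le_one algebra_simps)
qed (auto simp: valuation_ring_def algebra_simps)

lemma ideal_open_unit_ball: "ideal {x. v x < 1} (valuation_ring v)"
proof -
  interpret R: cring "valuation_ring v"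
    by (rule cring_valuation_ring)
  have neg: "\<ominus>\<^bsub>valuation_ring v\<^esub> x = - x" if "v x \<le> 1" for x
    by (rule R.minus_equality) (use that in \<open>auto simp: valuation_ring_def\<close>)
  have small: "v (x * y) < 1" if "v x < 1" "v y \<le> 1" for x y
    using mult_left_mono[OF that(2) nonneg[of x]] that(1) by (simp add: mult)
  show ?thesis
  proof (rule idealI)
    show "ring (valuation_ring v)"
      by (rule R.ring_axioms)
    show "subgroup {x. v x < 1} (add_monoid (valuation_ring v))"
    proof (rule R.add.subgroupI)
      fix x y assume "x \<in> {x. v x < 1}" "y \<in> {x. v x < 1}"
      thus "x \<oplus>\<^bsub>valuation_ring v\<^esub> y \<in> {x. v x < 1}"
        using ultrametric[of x y] by (auto simp: valuation_ring_def)
    qed (auto simp: neg, auto simp: valuation_ring_def intro: exI[of _ 0])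
  qed (use small in \<open>auto simp: valuation_ring_def mult.commute\<close>)
qed

lemma residue_char_eq: "residue_char v = Gcd {n. v (of_nat n) < 1}"
proof -
  interpret R: cring "valuation_ring v"
    by (rule cring_valuation_ring)
  interpret I: ideal "{x. v x < 1}" "valuation_ring v"
    by (rule ideal_open_unit_ball)
  interpret Q: ring "residue_field v"
    unfolding residue_field_def by (rule I.quotient_is_ring)
  have cl: "v (of_nat n) \<le> 1" for n
  proof (induction n)
    case (Suc n)
    thus ?case
      using ultrametric[of 1 "of_nat n"] by simp
  qed simp
  let ?h = "\<lambda>x. {x. v x < 1} +>\<^bsub>valuation_ring v\<^esub> x"
  have hom: "ring_hom_ring (valuation_ring v) (residue_field v) ?h"
    unfolding residue_field_def by (rule I.rcos_ring_hom_ring)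
  interpret H: ring_hom_ring "valuation_ring v" "residue_field v" ?h
    by (rule hom)
  have rv: "\<zero>\<^bsub>valuation_ring v\<^esub> = 0" "\<one>\<^bsub>valuation_ring v\<^esub> = 1"
    "x \<oplus>\<^bsub>valuation_ring v\<^esub> y = x + y" for x y
    by (simp_all add: valuation_ring_def)
  have car: "of_nat n \<in> carrier (valuation_ring v)" for n
    using cl by (simp add: valuation_ring_def)
  have pow: "add_pow (residue_field v) n \<one>\<^bsub>residue_field v\<^esub> = ?h (of_nat n)" for n :: nat
  proof (induction n)
    case 0
    show ?case
      using H.hom_zero by (simp only: rv Q.add.nat_pow_0 of_nat_0)
  next
    case (Suc n)
    have "?h (of_nat n + 1) = ?h (of_nat n) \<oplus>\<^bsub>residue_field v\<^esub> \<one>\<^bsub>residue_field v\<^esub>"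
      using H.hom_add[OF car R.one_closed, of n] H.hom_one by (simp only: rv)
    thus ?case
      by (simp only: Suc Q.add.nat_pow_Suc of_nat_Suc add.commute[of 1])
  qed
  have "add_pow (residue_field v) n \<one>\<^bsub>residue_field v\<^esub> = \<zero>\<^bsub>residue_field v\<^esub>
      \<longleftrightarrow> v (of_nat n) < 1" for n :: nat
  proof -
    have "?h (of_nat n) = {x. v x < 1} \<longleftrightarrow> of_nat n \<in> {x. v x < 1}"
      by (rule iffI, erule I.rcos_const_imp_mem[OF car], erule R.a_rcos_zero[OF I.ideal_axioms])
    moreover have "\<zero>\<^bsub>residue_field v\<^esub> = {x. v x < 1}"
      by (simp only: residue_field_def FactRing_def ring.simps)
    ultimately show ?thesis
      by (simp only: pow mem_Collect_eq)
  qed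
  thus ?thesis
    by (simp add: residue_char_def)
qed

end

end

theory Submission
  imports Defs
begin

text \<open>
  Move \<open>\<gamma>\<close> to \<open>0\<close> and write \<open>\<phi>(z) = z q(z)\<close> with \<open>q(0) = \<lambda>\<close>. Let \<open>r\<close> be the least absolute value of a
  root of \<open>q\<close> and \<open>s > r\<close> the radius for which \<open>\<phi>\<close> maps the open disk of radius \<open>s\<close> onto the open
  disk of radius \<open>r\<close>. On the latter, \<open>\<phi>\<close> scales absolute values by \<open>|\<lambda>| < 1\<close>, so a critical point
  in the disk of radius \<open>s\<close> is strictly attracted unless it is itself a root of \<open>\<phi>\<close>.
  Suppose all of them are roots, and let \<open>k\<close> be the number of roots of \<open>\<phi>\<close> in this disk. Comparing
  the \<open>k\<close>-th term of \<open>\<phi>\<close> with the Gauss norm of \<open>\<phi>'\<close> on the disk shows that the product of \<open>|x|/s\<close>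
  over the distinct nonzero roots \<open>x\<close> in the disk is at least \<open>|k|\<close>; as \<open>|\<lambda>|\<close> is
  \<open>r/s\<close> times the product of the \<open>k - 1\<close> factors \<open>|x|/s\<close> over the roots with multiplicity, it
  follows that \<open>|\<lambda>| \<ge> |k|^k\<close>.
\<close>

section \<open>Multiplicities under differentiation and products over multisets\<close>

text \<open>Writing \<open>f\<close> as (z - x)^(n+1) g, its derivative is (z - x)^n
  \<open>?h\<close>, and \<open>?h\<close> takes at \<open>x\<close> the value (n+1) g(x), nonzero
  because the multiplicity n+1 is nonzero in the field.\<close>

lemma order_pderiv_of_nat:
  fixes f :: "'a::field poly"
  assumes "f \<noteq> 0" "poly f x = 0" "of_nat (Polynomial.order x f) \<noteq> (0::'a)"
  shows "Polynomial.order x f = Suc (Polynomial.order x (pderiv f))"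
proof -
  obtain g where g: "f = [:- x, 1:] ^ Polynomial.order x f * g" "\<not> [:- x, 1:] dvd g"
    using order_decomp[OF assms(1)] by blast
  obtain n where n: "Polynomial.order x f = Suc n"
    using assms(1,2) order_root by (metis not0_implies_Suc)
  let ?h = "[:- x, 1:] * pderiv g + smult (of_nat (Suc n)) g"
  have "pderiv f = pderiv ([:- x, 1:] ^ Suc n * g)"
    using g(1) n by simp
  also have "\<dots> = [:- x, 1:] ^ n * ?h"
    unfolding lemma_order_pderiv1
    by (simp only: power_Suc distrib_left mult_smult_right mult_smult_left mult_ac)
  finally have "pderiv f = [:- x, 1:] ^ n * ?h" .
  moreover have h: "poly ?h x \<noteq> 0"
    using g(2) assms(3) by (simp add: n poly_eq_0_iff_dvd del: of_nat_Suc)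
  moreover from h have "?h \<noteq> 0" by (metis poly_0)
  moreover from h have "Polynomial.order x ?h = 0" by (rule order_0I)
  ultimately have "Polynomial.order x (pderiv f) = n"
    by (simp add: order_mult order_power_n_n del: of_nat_Suc mult_pCons_left)
  thus ?thesis using n by simp
qed

lemma proots_linear_factors: "proots (\<Prod>x\<in>#M. [:- x, 1:]) = (M :: 'a::idom multiset)"
proof (induction M)
  case (add x M)
  have "(\<Prod>x\<in>#M. [:- x, 1:]) \<noteq> 0" by (auto simp: prod_mset_zero_iff)
  hence "proots ([:- x, 1:] * (\<Prod>x\<in>#M. [:- x, 1:])) = {#x#} + proots (\<Prod>x\<in>#M. [:- x, 1:])"
    by (subst proots_mult) (simp_all del: mult_pCons_left)
  thus ?case using add by (simp del: mult_pCons_left)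
qed simp

lemma prod_mset_pos: "(\<And>x. x \<in># M \<Longrightarrow> 0 < f x) \<Longrightarrow> 0 < (\<Prod>x\<in>#M. f x)"
  for f :: "'a \<Rightarrow> real"
  by (induction M) auto

lemma prod_mset_mono_real:
  fixes f g :: "'a \<Rightarrow> real"
  assumes "\<And>x. x \<in># M \<Longrightarrow> 0 \<le> f x \<and> f x \<le> g x"
  shows "0 \<le> (\<Prod>x\<in>#M. f x) \<and> (\<Prod>x\<in>#M. f x) \<le> (\<Prod>x\<in>#M. g x)"
  using assms
proof (induction M)
  case (add a M)
  from add.prems[of a] have "0 \<le> f a" "f a \<le> g a" by simp_all
  moreover from this have "0 \<le> g a" by simp
  moreover have "0 \<le> (\<Prod>x\<in>#M. f x) \<and> (\<Prod>x\<in>#M. f x) \<le> (\<Prod>x\<in>#M. g x)"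
    using add by simp
  ultimately show ?case by (auto intro!: mult_mono)
qed simp

lemma power_size_le_prod_mset:
  fixes f :: "'a \<Rightarrow> real"
  assumes "0 \<le> b" "\<And>x. x \<in># M \<Longrightarrow> b \<le> f x"
  shows "b ^ size M \<le> (\<Prod>x\<in>#M. f x)"
  using prod_mset_mono_real[of M "\<lambda>_. b" f] assms by (simp add: image_mset_const_eq)

text \<open>Splits |f(0)| into the Gauss norm of f on the disk of radius \<open>s\<close> and a
  correction from the roots inside the disk.\<close>

lemma prod_mset_max_filter:
  fixes w :: "'a \<Rightarrow> real"
  assumes "s > 0"
  shows "(\<Prod>x\<in>#M. w x) = (\<Prod>x\<in>#M. max s (w x)) * (\<Prod>x\<in>#filter_mset (\<lambda>x. w x < s) M. w x / s)"
  using assms by (induction M) auto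

section \<open>Gauss norms of products of linear factors\<close>

context nonarch_absolute_value
begin

lemma v_diff: "v (x - y) \<le> max (v x) (v y)"
  using ultrametric[of x "- y"] by simp

lemma v_diff_less:
  assumes "v x < v y" shows "v (x - y) = v y"
  using v_diff[of x y] ultrametric[of "x - y" "- x"] assms by simp

lemma v_diff_eq_left:
  assumes "v y < v x" shows "v (x - y) = v x"
  using v_diff_less[OF assms] by (metis v_minus minus_diff_eq)

lemma v_prod_mset: "v (\<Prod>x\<in>#M. f x) = (\<Prod>x\<in>#M. v (f x))"
  by (induction M) (auto simp: mult)

lemma v_of_nat_le_1: "v (of_nat n) \<le> 1"
proof (induction n)
  case (Suc n)
  thus ?case using ultrametric[of 1 "of_nat n"] by simp
qed simp

text \<open>Multiplicativity of the Gauss norm of radius \<open>s\<close>, the factor z - x having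
  norm max s |x|. The least index attaining the norm is the number of roots in the open disk, as on
  a Newton polygon.\<close>

lemma coeff_linear_factors:
  fixes M :: "'a multiset"
  assumes "s > 0"
  defines "f \<equiv> \<Prod>x\<in>#M. [:- x, 1:]"
    and "N \<equiv> \<Prod>x\<in>#M. max s (v x)"
    and "k \<equiv> size (filter_mset (\<lambda>x. v x < s) M)"
  shows "(\<forall>i. v (coeff f i) * s ^ i \<le> N) \<and> (\<forall>i<k. v (coeff f i) * s ^ i < N) \<and>
    v (coeff f k) * s ^ k = N"
  unfolding f_def N_def k_def
proof (induction M)
  case empty
  show ?case using assms(1) by (auto simp: nonneg coeff_pCons split: nat.splits)
next
  case (add a M)
  define f where "f = (\<Prod>x\<in>#M. [:- x, 1:])"
  define N where "N = (\<Prod>x\<in>#M. max s (v x))"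
  define k where "k = size (filter_mset (\<lambda>x. v x < s) M)"
  define c where "c i = coeff f i" for i
  define b where "b i = coeff ([:- a, 1:] * f) i" for i
  from add have IH: "v (c i) * s ^ i \<le> N" "i < k \<Longrightarrow> v (c i) * s ^ i < N"
    "v (c k) * s ^ k = N" for i
    unfolding c_def f_def N_def k_def by blast+
  have N: "N > 0" unfolding N_def using assms(1) by (intro prod_mset_pos) auto
  have b0: "b 0 = - (a * c 0)" and bS: "b (Suc i) = c i - a * c (Suc i)" for i
    by (simp_all add: b_def c_def)
  have hi: "v (a * c i) * s ^ i = v a * (v (c i) * s ^ i)" for i
    by (simp add: mult)
  have hs: "v (c i) * s ^ Suc i = s * (v (c i) * s ^ i)" for i
    by simp
  have bS_le: "v (b (Suc i)) * s ^ Suc i \<le> max (s * (v (c i) * s ^ i)) (v a * (v (c (Suc i)) * s ^ Suc i))" for i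
  proof -
    have "v (b (Suc i)) * s ^ Suc i \<le> max (v (c i)) (v (a * c (Suc i))) * s ^ Suc i"
      unfolding bS using assms(1) v_diff by (intro mult_right_mono) auto
    also have "\<dots> = max (v (c i) * s ^ Suc i) (v (a * c (Suc i)) * s ^ Suc i)"
      using assms(1) by (simp add: max_mult_distrib_right)
    finally show ?thesis by (simp only: hi hs)
  qed
  have b0_eq: "v (b 0) * s ^ 0 = v a * (v (c 0) * s ^ 0)"
    by (simp add: b0 mult)
  \<comment> \<open>Multiplying by z - a gives b_i = c_(i-1) - a c_i. The shifted term prevails if
    |a| < s, which moves the least index up by one; otherwise a c_i prevails and the index
    stays.\<close>
  have "(\<forall>i. v (b i) * s ^ i \<le> max s (v a) * N) \<and>
      (\<forall>i < (if v a < s then Suc k else k). v (b i) * s ^ i < max s (v a) * N) \<and>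
      v (b (if v a < s then Suc k else k)) * s ^ (if v a < s then Suc k else k) = max s (v a) * N"
  proof (intro conjI allI impI)
    have le: "s * (v (c i) * s ^ i) \<le> max s (v a) * N" "v a * (v (c i) * s ^ i) \<le> max s (v a) * N" for i
      using IH(1)[of i] assms(1) nonneg[of a] nonneg[of "c i"] by (auto intro!: mult_mono)
    show "v (b i) * s ^ i \<le> max s (v a) * N" for i
    proof (cases i)
      case 0
      thus ?thesis using b0_eq le(2)[of 0] by simp
    next
      case (Suc j)
      thus ?thesis using bS_le[of j] le(1)[of j] le(2)[of "Suc j"] by (simp only: Suc)
    qed
  next
    fix i assume i: "i < (if v a < s then Suc k else k)"
    have lt1: "s * (v (c j) * s ^ j) < max s (v a) * N" if "j < k" for j
    proof -
      have "s * (v (c j) * s ^ j) < s * N" using IH(2)[OF that] assms(1) by simp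
      also have "\<dots> \<le> max s (v a) * N" using N by simp
      finally show ?thesis .
    qed
    have lt2: "v a * (v (c i) * s ^ i) < max s (v a) * N"
    proof (cases "v a < s")
      case True
      have "v a * (v (c i) * s ^ i) \<le> v a * N" using IH(1) nonneg by (intro mult_left_mono) auto
      also have "\<dots> < s * N" using True N by simp
      finally show ?thesis using True by simp
    next
      case False
      have "v a * (v (c i) * s ^ i) < v a * N"
        using IH(2)[of i] i False assms(1) by (intro mult_strict_left_mono) auto
      thus ?thesis using False by simp
    qed
    show "v (b i) * s ^ i < max s (v a) * N"
    proof (cases i)
      case 0
      thus ?thesis using b0_eq lt2 by simp
    next
      case (Suc j)
      hence "j < k" using i by (auto split: if_splits)
      thus ?thesis using le_less_trans[OF bS_le[of j]] lt1[of j] lt2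
        unfolding Suc max_less_iff_conj by blast
    qed
  next
    show "v (b (if v a < s then Suc k else k)) * s ^ (if v a < s then Suc k else k) = max s (v a) * N"
    proof (cases "v a < s")
      case True
      have "v a * (v (c (Suc k)) * s ^ Suc k) \<le> v a * N"
        by (intro mult_left_mono IH(1) nonneg)
      also have "\<dots> < s * N" using True N by simp
      also have "\<dots> = v (c k) * s ^ Suc k" by (simp only: hs IH(3))
      finally have "v (a * c (Suc k)) * s ^ Suc k < v (c k) * s ^ Suc k" by (simp only: hi)
      hence "v (a * c (Suc k)) < v (c k)" using assms(1) by (simp del: power_Suc)
      hence "v (b (Suc k)) = v (c k)" unfolding bS by (rule v_diff_eq_left)
      hence "v (b (Suc k)) * s ^ Suc k = s * N" by (simp only: hs IH(3))
      thus ?thesis using True by simp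
    next
      case False
      have "v (b k) = v (a * c k)"
      proof (cases k)
        case (Suc j)
        \<comment> \<open>The strict bound below index \<open>k\<close> makes a c_k dominate even
          when |a| = s.\<close>
        have "v (c j) * s ^ k = s * (v (c j) * s ^ j)" by (simp add: Suc)
        also have "\<dots> < s * N" using IH(2)[of j] Suc assms(1) by simp
        also have "\<dots> \<le> v a * N" using False N by simp
        also have "\<dots> = v (a * c k) * s ^ k" by (simp only: hi IH(3))
        finally have "v (c j) < v (a * c k)" using assms(1) by simp
        thus ?thesis unfolding Suc bS by (rule v_diff_less)
      qed (simp add: b0)
      hence "v (b k) * s ^ k = v a * N" by (simp only: hi IH(3))
      thus ?thesis using False by simp
    qed
  qed
  thus ?case
    by (auto simp: b_def f_def N_def k_def split: if_splits simp del: mult_pCons_left)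
qed

text \<open>Passing to \<open>f'\<close> lowers the multiplicity of each root of \<open>f\<close> by one, as it is not divisible by
  the characteristic.\<close>

lemma filter_linear_factors_pderiv:
  fixes f :: "'a poly" and M P :: "'a multiset"
  assumes f: "f = smult C (\<Prod>x\<in>#M. [:- x, 1:])" "C \<noteq> 0"
    and f': "pderiv f = smult C' (\<Prod>x\<in>#P. [:- x, 1:])" "C' \<noteq> 0"
    and char: "\<And>m. 1 \<le> m \<Longrightarrow> m \<le> degree f \<Longrightarrow> of_nat m \<noteq> (0::'a)"
    and crit: "\<And>c. Q c \<Longrightarrow> poly (pderiv f) c = 0 \<Longrightarrow> poly f c = 0"
  shows "filter_mset Q M = filter_mset Q P + mset_set (set_mset (filter_mset Q M))"
proof -
  have "f \<noteq> 0" using f by (auto simp: prod_mset_zero_iff)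
  have "pderiv f \<noteq> 0" using f' by (auto simp: prod_mset_zero_iff)
  have M: "proots f = M" and P: "proots (pderiv f) = P"
    using f f' by (simp_all add: proots_linear_factors)
  have "count (filter_mset Q M) x =
      count (filter_mset Q P + mset_set (set_mset (filter_mset Q M))) x" for x
  proof (cases "Q x \<and> x \<in># M")
    case True
    hence x: "poly f x = 0" using M \<open>f \<noteq> 0\<close> by (metis set_count_proots mem_Collect_eq)
    have "Polynomial.order x f \<noteq> 0" using x \<open>f \<noteq> 0\<close> order_root by blast
    moreover have "Polynomial.order x f \<le> degree f"
      using \<open>f \<noteq> 0\<close> by (rule order_degree)
    ultimately have "Polynomial.order x f = Suc (Polynomial.order x (pderiv f))"
      using char \<open>f \<noteq> 0\<close> x by (intro order_pderiv_of_nat) auto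
    hence "count M x = Suc (count P x)"
      using \<open>f \<noteq> 0\<close> \<open>pderiv f \<noteq> 0\<close> by (metis M P count_proots)
    thus ?thesis using True by simp
  next
    case False
    \<comment> \<open>By \<open>crit\<close>, critical points satisfying \<open>Q\<close> are roots
      of \<open>f\<close>, so no further ones occur outside \<open>M\<close>.\<close>
    have "count P x = 0" if "Q x"
    proof (rule ccontr)
      assume "count P x \<noteq> 0"
      hence "x \<in># P" by simp
      hence "poly (pderiv f) x = 0"
        using P \<open>pderiv f \<noteq> 0\<close> by (metis set_count_proots mem_Collect_eq)
      hence "poly f x = 0" using crit that by blast
      hence "x \<in># M" using M \<open>f \<noteq> 0\<close> by (metis set_count_proots mem_Collect_eq)
      with False that show False by blast
    qed
    thus ?thesis using False by (auto simp: not_in_iff)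
  qed
  thus ?thesis by (rule multiset_eqI)
qed

section \<open>The radius \<open>s\<close> and attraction near the fixed point\<close>

text \<open>Intermediate value theorem for the Gauss norm \<open>N\<close> of C z times the product
  of the z - x: it equals L r < r at \<open>r\<close>, and is at least L (r/L) = r at r/L.\<close>

lemma exists_radius:
  fixes w :: "'a \<Rightarrow> real"
  assumes "0 < r" "0 < C" "\<And>x. x \<in># M \<Longrightarrow> r \<le> w x" "C * (\<Prod>x\<in>#M. w x) < 1"
  shows "\<exists>s>r. C * s * (\<Prod>x\<in>#M. max s (w x)) = r"
proof -
  define L where "L = C * (\<Prod>x\<in>#M. w x)"
  define N where "N s = C * s * (\<Prod>x\<in>#M. max s (w x))" for s
  have pos: "0 < w x" if "x \<in># M" for x using assms(1,3) that by force
  have "L > 0" unfolding L_def using assms(2) pos by (intro mult_pos_pos prod_mset_pos) auto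
  have "image_mset (\<lambda>x. max r (w x)) M = image_mset w M"
    using assms(3) by (intro image_mset_cong) auto
  hence Nr: "N r = L * r" by (simp add: N_def L_def mult_ac)
  have Lr: "L * r < r" using assms(1,4) by (simp add: L_def)
  have "(\<Prod>x\<in>#M. w x) \<le> (\<Prod>x\<in>#M. max (r / L) (w x))"
    using prod_mset_mono_real[of M w "\<lambda>x. max (r / L) (w x)"] pos by (auto simp: less_imp_le)
  hence "C * (r / L) * (\<Prod>x\<in>#M. w x) \<le> N (r / L)"
    unfolding N_def using assms(1,2) \<open>L > 0\<close> by (intro mult_left_mono) auto
  moreover have "C * (r / L) * (\<Prod>x\<in>#M. w x) = L * (r / L)"
    by (simp only: L_def mult_ac times_divide_eq_right)
  ultimately have "r \<le> N (r / L)" using \<open>L > 0\<close> by simp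
  moreover have "r \<le> r / L"
    using Lr assms(1) \<open>L > 0\<close> by (simp add: pos_le_divide_eq mult.commute)
  moreover have "continuous_on {r..r / L} (\<lambda>s. \<Prod>x\<in>#M. max s (w x))"
    by (induction M) (auto intro!: continuous_intros)
  hence "continuous_on {r..r / L} N"
    unfolding N_def by (intro continuous_intros)
  ultimately obtain s where "r \<le> s" "N s = r"
    using IVT'[of N r r "r / L"] Nr Lr by auto
  moreover have "s \<noteq> r" using \<open>N s = r\<close> Nr Lr by auto
  ultimately show ?thesis by (intro exI[of _ s]) (auto simp: N_def)
qed

text \<open>One step enters the disk of radius \<open>r\<close>, and each later step multiplies the
  absolute value by \<open>L\<close>: it tends to 0 but never vanishes.\<close>

lemma strictly_attracted_zero:
  assumes scale: "\<And>w. v w < r \<Longrightarrow> v (f w) = L * v w"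
    and L: "0 < L" "L < 1" and z: "v (f z) < r" "f z \<noteq> 0"
  shows "strictly_attracted v f 0 z"
proof -
  have iter: "v ((f ^^ Suc n) z) = L ^ n * v (f z)" for n
  proof (induction n)
    case (Suc n)
    have "L ^ n * v (f z) \<le> 1 * v (f z)"
      using L nonneg by (intro mult_right_mono power_le_one) auto
    hence "v ((f ^^ Suc n) z) < r" using Suc z(1) by simp
    from scale[OF this] have "v ((f ^^ Suc (Suc n)) z) = L * v ((f ^^ Suc n) z)" by simp
    thus ?case by (simp only: Suc power_Suc mult.assoc)
  qed simp
  have "(\<lambda>n. L ^ n * v (f z)) \<longlonglongrightarrow> 0 * v (f z)"
    using L by (intro tendsto_mult LIMSEQ_power_zero tendsto_const) auto
  hence "(\<lambda>n. v ((f ^^ Suc n) z)) \<longlonglongrightarrow> 0" by (simp only: iter mult_zero_left)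
  hence "(\<lambda>n. v ((f ^^ n) z)) \<longlonglongrightarrow> 0" by (rule LIMSEQ_imp_Suc)
  moreover have "(f ^^ l) z \<noteq> 0" if "l \<ge> 1" for l
  proof -
    obtain n where "l = Suc n" using \<open>l \<ge> 1\<close> by (cases l) auto
    moreover have "L ^ n * v (f z) \<noteq> 0" using L z(2) eq_zero_iff by simp
    ultimately show ?thesis using iter[of n] v_zero by metis
  qed
  ultimately show ?thesis by (simp add: strictly_attracted_iff)
qed

section \<open>The lower bound for the multiplier\<close>

lemma le_multiplier_of_critical_roots:
  fixes f :: "'a poly" and M P :: "'a multiset"
  assumes f: "f = smult C (\<Prod>x\<in>#add_mset 0 M. [:- x, 1:])" "C \<noteq> 0"
    and f': "pderiv f = smult C' (\<Prod>x\<in>#P. [:- x, 1:])" "C' \<noteq> 0"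
    and char: "\<And>m. 1 \<le> m \<Longrightarrow> m \<le> degree f \<Longrightarrow> of_nat m \<noteq> (0::'a)"
    and r: "v a = r" "a \<in># M" "0 < r" "r < s"
    and s: "v C * s * (\<Prod>x\<in>#M. max s (v x)) = r"
    and M0: "0 \<notin># M"
    and crit: "\<And>c. v c < s \<Longrightarrow> poly (pderiv f) c = 0 \<Longrightarrow> poly f c = 0"
  defines "k \<equiv> Suc (size (filter_mset (\<lambda>x. v x < s) M))"
  shows "v (of_nat k) ^ k \<le> v (poly (pderiv f) 0)"
proof -
  define \<mu> where "\<mu> = v (poly (pderiv f) 0)"
  define Q where "Q = filter_mset (\<lambda>x. v x < s) M"
  define P' where "P' = filter_mset (\<lambda>x. v x < s) P"
  define A where "A = (\<Prod>x\<in>#mset_set (set_mset Q). v x / s)"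
  define K where "K = v (of_nat k)"
  define f1 where "f1 = (\<Prod>x\<in>#add_mset 0 M. [:- x, 1:])"
  define f2 where "f2 = (\<Prod>x\<in>#P. [:- x, 1:])"
  have s0: "s > 0" using r by simp
  have "filter_mset (\<lambda>x. v x < s) (add_mset 0 M) =
      P' + mset_set (set_mset (filter_mset (\<lambda>x. v x < s) (add_mset 0 M)))"
    unfolding P'_def using f f' char crit by (rule filter_linear_factors_pderiv)
  moreover have "filter_mset (\<lambda>x. v x < s) (add_mset 0 M) = add_mset 0 Q" "0 \<notin># Q"
    using s0 M0 by (simp_all add: Q_def)
  \<comment> \<open>The simple root 0 occurs once on each side and cancels.\<close>
  ultimately have QP: "Q = P' + mset_set (set_mset Q)" by simp
  have "f = [:0, 1:] * smult C (\<Prod>x\<in>#M. [:- x, 1:])"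
    unfolding f(1) by simp
  hence "poly (pderiv f) 0 = C * (\<Prod>x\<in>#M. - x)"
    by (simp add: pderiv_pCons poly_prod_mset)
  hence mu1: "\<mu> = v C * (\<Prod>x\<in>#M. v x)" by (simp add: \<mu>_def mult v_prod_mset)
  have "s * \<mu> = r * (\<Prod>x\<in>#Q. v x / s)"
    unfolding mu1 prod_mset_max_filter[OF s0, of v M] s[symmetric] Q_def by (simp add: mult_ac)
  hence mu2: "\<mu> = r / s * (\<Prod>x\<in>#Q. v x / s)" using s0 by (simp add: field_simps)
  \<comment> \<open>The multiplier is computed a second time, now from the critical points.\<close>
  have "poly (pderiv f) 0 = C' * (\<Prod>x\<in>#P. - x)"
    unfolding f'(1) by (simp add: poly_prod_mset)
  hence "\<mu> = v C' * (\<Prod>x\<in>#P. v x)" by (simp add: \<mu>_def mult v_prod_mset)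
  hence mu3: "\<mu> = v C' * (\<Prod>x\<in>#P. max s (v x)) * (\<Prod>x\<in>#P'. v x / s)"
    unfolding prod_mset_max_filter[OF s0, of v P] P'_def by (simp add: mult_ac)
  \<comment> \<open>\<open>k\<close> counts the roots in the disk including 0, so the
    \<open>k\<close>-th term attains the Gauss norm of \<open>f\<close>, which is \<open>r\<close>
    by the choice of \<open>s\<close>.\<close>
  have "v (coeff f1 k) * s ^ k = (\<Prod>x\<in>#add_mset 0 M. max s (v x))"
    using coeff_linear_factors[OF s0, of "add_mset 0 M"] s0 by (simp add: f1_def k_def)
  hence ck: "v (coeff f k) * s ^ k = r"
    using s s0 unfolding f(1) f1_def[symmetric] by (simp add: mult mult_ac)
  \<comment> \<open>Coefficient k - 1 of f' is k times coefficient k of f, and each term is bounded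
    by the Gauss norm of f'.\<close>
  have "K * r / s = v (coeff (pderiv f) (k - 1)) * s ^ (k - 1)"
    using s0 unfolding ck[symmetric] by (simp add: K_def k_def coeff_pderiv mult del: of_nat_Suc)
  also have "\<dots> \<le> v C' * (\<Prod>x\<in>#P. max s (v x))"
    using coeff_linear_factors[OF s0, of P] nonneg[of C']
    by (simp add: f'(1) mult mult.assoc mult_left_mono)
  finally have gauss: "K * r / s \<le> v C' * (\<Prod>x\<in>#P. max s (v x))" .
  have x0: "0 < v x" if "x \<in># M" for x
    using that M0 nonneg[of x] eq_zero_iff[of x] by (metis less_eq_real_def)
  have Qx: "0 < v x / s" "v x / s < 1" if "x \<in># Q" for x
    using that x0 s0 by (auto simp: Q_def)
  have P'0: "(\<Prod>x\<in>#P'. v x / s) > 0"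
    by (rule prod_mset_pos, rule Qx(1), subst QP) simp
  \<comment> \<open>Both expressions for the multiplier contain the product over \<open>P'\<close>;
    cancelling it leaves \<open>A\<close>, the product over distinct roots.\<close>
  have "K * r / s * (\<Prod>x\<in>#P'. v x / s) \<le> \<mu>"
    unfolding mu3 using gauss P'0 by (intro mult_right_mono) auto
  also have "\<mu> = r / s * ((\<Prod>x\<in>#P'. v x / s) * A)"
    unfolding mu2 by (subst QP) (simp only: image_mset_union prod_mset_Un A_def)
  finally have "(r / s * (\<Prod>x\<in>#P'. v x / s)) * K \<le> (r / s * (\<Prod>x\<in>#P'. v x / s)) * A"
    by (simp only: mult_ac times_divide_eq_left times_divide_eq_right)
  hence KA: "K \<le> A"
    using P'0 r(3) s0 by (subst (asm) mult_le_cancel_left_pos) auto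
  \<comment> \<open>The remaining factors of \<open>A\<close> are below 1.\<close>
  have Ax: "A \<le> v x / s" if "x \<in># Q" for x
  proof -
    let ?B = "mset_set (set_mset Q - {x})"
    have "A = v x / s * (\<Prod>y\<in>#?B. v y / s)"
      unfolding A_def using that by (subst mset_set.remove[of _ x]) auto
    moreover have "(\<Prod>y\<in>#?B. v y / s) \<le> (\<Prod>y\<in>#?B. 1)"
      using Qx prod_mset_mono_real[of ?B "\<lambda>y. v y / s" "\<lambda>_. 1"] by (simp add: less_imp_le)
    ultimately show ?thesis
      using mult_left_mono[of "\<Prod>y\<in>#?B. v y / s" 1 "v x / s"] Qx(1)[OF that] by simp
  qed
  have "0 \<le> K" by (simp add: K_def nonneg)
  hence "K ^ size Q \<le> (\<Prod>x\<in>#Q. v x / s)"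
    using KA Ax by (intro power_size_le_prod_mset) force+
  \<comment> \<open>The root \<open>a\<close> of least absolute value lies in the disk since r < s;
    it supplies the last of the \<open>k\<close> factors.\<close>
  moreover have "K \<le> r / s"
    using KA Ax[of a] r by (simp add: Q_def)
  ultimately have "K * K ^ size Q \<le> \<mu>"
    unfolding mu2 using \<open>0 \<le> K\<close> r(3) s0 by (intro mult_mono) auto
  thus ?thesis by (simp add: K_def k_def Q_def \<mu>_def)
qed

section \<open>Bounds for epsilon\<close>

lemma poly_epsilon_ge:
  assumes "d \<ge> 1"
  shows "Min ((\<lambda>m. v (of_nat m) ^ d) ` {1..d}) \<le> poly_epsilon v d"
proof -
  have "Min ((\<lambda>m. v (of_nat m) ^ d) ` {1..d}) \<le> v (of_nat m) ^ m" if "m \<in> {1..d}" for m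
  proof -
    have "Min ((\<lambda>m. v (of_nat m) ^ d) ` {1..d}) \<le> v (of_nat m) ^ d"
      using that by (intro Min_le) auto
    also have "\<dots> \<le> v (of_nat m) ^ m"
      using that by (intro power_decreasing nonneg v_of_nat_le_1) auto
    finally show ?thesis .
  qed
  thus ?thesis
    unfolding poly_epsilon_def using assms by (intro Min.boundedI) auto
qed

lemma poly_epsilon_le:
  "m \<in> {1..d} \<Longrightarrow> poly_epsilon v d \<le> v (of_nat m) ^ m"
  unfolding poly_epsilon_def by (intro Min_le) auto

end

section \<open>The fixed point 0, then the general case by translation\<close>

lemma strictly_attracted_critical_point_zero:
  fixes v :: "'a::alg_closed_field \<Rightarrow> real" and f :: "'a poly"
  assumes "nonarch_absolute_value v"
    and char: "CHAR('a) = 0 \<or> CHAR('a) > degree f"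
    and deg: "degree f \<ge> 2" and f0: "poly f 0 = 0"
    and mu: "0 < v (poly (pderiv f) 0)" "v (poly (pderiv f) 0) < poly_epsilon v (degree f)"
  shows "\<exists>c. poly (pderiv f) c = 0 \<and> strictly_attracted v (poly f) 0 c"
proof (rule ccontr)
  interpret nonarch_absolute_value v by fact
  assume no: "\<nexists>c. poly (pderiv f) c = 0 \<and> strictly_attracted v (poly f) 0 c"
  define \<mu> where "\<mu> = v (poly (pderiv f) 0)"
  have mu0: "poly (pderiv f) 0 \<noteq> 0" using mu(1) by auto
  \<comment> \<open>The term m = 1 of the minimum shows that epsilon is at most 1.\<close>
  have mu1: "0 < \<mu>" "\<mu> < 1"
    using mu poly_epsilon_le[of 1 "degree f"] deg by (auto simp: \<mu>_def)
  from f0 obtain q where q: "f = [:0, 1:] * q"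
    by (metis dvdE minus_zero poly_eq_0_iff_dvd)
  define C where "C = lead_coeff q"
  have "f \<noteq> 0" using deg by auto
  hence "q \<noteq> 0" using q by auto
  hence C0: "C \<noteq> 0" by (simp add: C_def)
  have degq: "degree f = Suc (degree q)" unfolding q using \<open>q \<noteq> 0\<close> by simp
  obtain M where M: "size M = degree q" "q = smult C (\<Prod>x\<in>#M. [:- x, 1:])"
    unfolding C_def using alg_closed_imp_factorization[OF \<open>q \<noteq> 0\<close>] by blast
  have "pderiv f \<noteq> 0" using mu0 by auto
  define C' where "C' = lead_coeff (pderiv f)"
  have C'0: "C' \<noteq> 0" using \<open>pderiv f \<noteq> 0\<close> by (simp add: C'_def)
  obtain P where P: "pderiv f = smult C' (\<Prod>x\<in>#P. [:- x, 1:])"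
    unfolding C'_def using alg_closed_imp_factorization[OF \<open>pderiv f \<noteq> 0\<close>] by blast
  have fM: "f = smult C (\<Prod>x\<in>#add_mset 0 M. [:- x, 1:])"
    unfolding q by (subst M(2)) simp
  have vq: "v (poly q z) = v C * (\<Prod>x\<in>#M. v (z - x))" for z
    by (subst M(2)) (simp add: mult poly_prod_mset v_prod_mset)
  have "poly (pderiv f) 0 = poly q 0" unfolding q by (simp add: pderiv_pCons)
  hence muq: "\<mu> = v C * (\<Prod>x\<in>#M. v x)" using vq[of 0] by (simp add: \<mu>_def)
  have M0: "0 \<notin># M"
  proof
    assume "0 \<in># M"
    hence "(\<Prod>x\<in>#M. v x) = 0" using v_zero by (metis image_eqI prod_mset_zero_iff set_image_mset)
    with muq mu1 show False by simp
  qed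
  define r where "r = Min (v ` set_mset M)"
  have "M \<noteq> {#}" using M(1) degq deg by auto
  hence rM: "r \<in> v ` set_mset M" unfolding r_def by (intro Min_in) auto
  then obtain a where a: "a \<in># M" "v a = r" by blast
  have r_le: "r \<le> v x" if "x \<in># M" for x unfolding r_def using that by (intro Min_le) auto
  have r0: "r > 0" using a M0 nonneg[of a] eq_zero_iff[of a] by (metis less_eq_real_def)
  have vC: "v C > 0" using C0 nonneg[of C] eq_zero_iff[of C] by linarith
  obtain s where s: "s > r" "v C * s * (\<Prod>x\<in>#M. max s (v x)) = r"
    using exists_radius[of r "v C" M v] r0 vC r_le mu1(2) muq by auto
  \<comment> \<open>Here |z - x| = |x| for every root x of \<open>q\<close>, so |q(z)| =
    |q(0)|.\<close>
  have scale: "v (poly f z) = \<mu> * v z" if "v z < r" for z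
  proof -
    have "image_mset (\<lambda>x. v (z - x)) M = image_mset v M"
      using r_le that by (intro image_mset_cong v_diff_less) force
    thus ?thesis by (simp add: q mult vq muq)
  qed
  \<comment> \<open>The factors z - x give only a weak bound; the factor z makes it strict.\<close>
  have into: "v (poly f z) < r" if "v z < s" for z
  proof -
    have "(\<Prod>x\<in>#M. v (z - x)) \<le> (\<Prod>x\<in>#M. max s (v x))"
      using prod_mset_mono_real[of M "\<lambda>x. v (z - x)" "\<lambda>x. max s (v x)"] v_diff[of z] that nonneg
      by (smt (verit))
    hence "v (poly f z) \<le> v z * (v C * (\<Prod>x\<in>#M. max s (v x)))"
      unfolding q by (simp add: mult vq mult_left_mono nonneg)
    also have "\<dots> < s * (v C * (\<Prod>x\<in>#M. max s (v x)))"
      using that vC r0 s(1) by (intro mult_strict_right_mono mult_pos_pos prod_mset_pos) auto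
    finally show ?thesis using s(2) by (simp add: mult_ac)
  qed
  have crit: "poly f c = 0" if "v c < s" "poly (pderiv f) c = 0" for c
    using no that strictly_attracted_zero[OF scale mu1 into] by blast
  have char': "of_nat m \<noteq> (0::'a)" if "1 \<le> m" "m \<le> degree f" for m
    using char that by (auto simp: of_nat_eq_0_iff_char_dvd dest: dvd_imp_le)
  define k where "k = Suc (size (filter_mset (\<lambda>x. v x < s) M))"
  have "v (of_nat k) ^ k \<le> \<mu>"
    unfolding k_def \<mu>_def
    by (rule le_multiplier_of_critical_roots[OF fM C0 P C'0 char' a(2,1) r0 s M0 crit])
  \<comment> \<open>\<open>M\<close> has d - 1 elements, so \<open>k\<close> is one of the indices
    in the minimum defining epsilon.\<close>
  moreover have "k \<le> degree f"
    unfolding k_def degq M(1)[symmetric] by (simp add: size_filter_mset_lesseq)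
  hence "poly_epsilon v (degree f) \<le> v (of_nat k) ^ k"
    by (intro poly_epsilon_le) (auto simp: k_def)
  ultimately show False using mu(2) by (simp add: \<mu>_def)
qed

theorem theorem5p1:
  fixes v :: "'a::alg_closed_field \<Rightarrow> real"
    and p d :: nat
    and \<phi> :: "'a poly"
    and \<gamma> :: 'a
  assumes "complete_nonarch_field v"
    and "residue_char v = p"
    and "d \<ge> 2"
    and "CHAR('a) = 0 \<or> CHAR('a) > d"
    and "degree \<phi> = d"
    and "poly \<phi> \<gamma> = \<gamma>"
    and "0 < v (poly (pderiv \<phi>) \<gamma>)"
    and "v (poly (pderiv \<phi>) \<gamma>) < poly_epsilon v d"
  shows "poly_epsilon v d \<ge> Min ((\<lambda>m. v (of_nat m) ^ d) ` {1..d}) \<and>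
    (\<exists>c. poly (pderiv \<phi>) c = 0 \<and> strictly_attracted v (poly \<phi>) \<gamma> c)"
proof
  interpret complete_nonarch_field v by fact
  show "Min ((\<lambda>m. v (of_nat m) ^ d) ` {1..d}) \<le> poly_epsilon v d"
    using assms(3) by (intro poly_epsilon_ge) simp
  \<comment> \<open>Conjugation by z -> z + \<gamma> moves the fixed point to 0; critical points and
    orbits are shifted by \<gamma>.\<close>
  define f where "f = pcompose \<phi> [:\<gamma>, 1:] - [:\<gamma>:]"
  have f: "poly f z = poly \<phi> (z + \<gamma>) - \<gamma>" for z
    by (simp add: f_def poly_pcompose add.commute)
  have f': "poly (pderiv f) z = poly (pderiv \<phi>) (z + \<gamma>)" for z
    by (simp add: f_def pderiv_diff pderiv_pcompose pderiv_pCons poly_pcompose add.commute)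
  have deg: "degree f = d"
    using degree_add_eq_left[of "[:- \<gamma>:]" "pcompose \<phi> [:\<gamma>, 1:]"] assms(3,5)
    by (simp add: f_def degree_pcompose diff_conv_add_uminus del: add_uminus_conv_diff)
  have iter: "(poly \<phi> ^^ n) (z + \<gamma>) = (poly f ^^ n) z + \<gamma>" for n z
    by (induction n) (simp_all add: f)
  have "\<exists>c. poly (pderiv f) c = 0 \<and> strictly_attracted v (poly f) 0 c"
    using assms(3,4,6-8) deg nonarch_absolute_value_axioms
    by (intro strictly_attracted_critical_point_zero) (simp_all add: f f')
  then obtain c where "poly (pderiv f) c = 0" "strictly_attracted v (poly f) 0 c" by blast
  hence "poly (pderiv \<phi>) (c + \<gamma>) = 0 \<and> strictly_attracted v (poly \<phi>) \<gamma> (c + \<gamma>)"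
    by (simp add: f' strictly_attracted_iff iter)
  thus "\<exists>c. poly (pderiv \<phi>) c = 0 \<and> strictly_attracted v (poly \<phi>) \<gamma> c" by blast
qed

end
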